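(* Assume that the BDF2 kernels $b^{(n)}_{n-k}$ are positive semi-definite (or that the sufficient condition $0<r_k\le\frac{3+\sqrt{17}}{2}$ for $2\le k\le N$ holds), and that the maximum time-step size satisfies $\tau\le 1/(4\kappa^{*})$. Then the solution $u^n$ of the adaptive BDF2 scheme satisfies $$\|u^{n}\|\le 2\exp(4\kappa^{*}t_{n-1})\Big(\|u^{0}\|+2\sum_{k=1}^{n}\sum_{j=1}^{k}\theta_{k-j}^{(k)}\|f^j\|\Big)\qquad\text{for }1\le n\le N.$$
   Context: Let $\Omega$ be a bounded convex domain with smooth boundary, $\varepsilon>0$ a constant, $\kappa=\kappa(x)$ a smooth function on $\Omega$ with $|\kappa(x)|\le\kappa^*$ for a constant $\kappa^*>0$, $T>0$. $\langle\cdot,\cdot\rangle$ and $\|\cdot\|$ are the $L^2(\Omega)$ inner product and norm. Time mesh: $0=t_0<t_1<\cdots<t_N=T$, $\tau_k=t_k-t_{k-1}$ for $1\le k\le N$, $\tau=\max_{1\le k\le N}\tau_k$, $r_k=\tau_k/\tau_{k-1}$ for $2\le k\le N$. BDF2 kernels: $b^{(1)}_0=1/\tau_1$ and, for $2\le n\le N$, $$b^{(n)}_0=\frac{1+2r_n}{\tau_n(1+r_n)},\quad b^{(n)}_1=-\frac{r_n^2}{\tau_n(1+r_n)},\quad b^{(n)}_j=0\ \ (2\le j\le n-1).$$ They are called positive semi-definite if $\sum_{k=1}^nw_k\sum_{j=1}^kb_{k-j}^{(k)}w_j\ge0$ for every $1\le n\le N$ and all real $w_1,\dots,w_n$. BDF2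 operator: $D_2v^n=\sum_{k=1}^nb^{(n)}_{n-k}(v^k-v^{k-1})$ for $1\le n\le N$ (so the first step is BDF1). Discrete orthogonal convolution (DOC) kernels: for $1\le n\le N$, $$\theta_{0}^{(n)}=\frac{1}{b^{(n)}_{0}},\qquad \theta_{n-k}^{(n)}=-\frac{1}{b^{(k)}_{0}}\sum_{j=k+1}^{n}\theta_{n-j}^{(n)}b^{(j)}_{j-k}\quad(1\le k\le n-1).$$ Adaptive BDF2 scheme: given $u^0\in L^2(\Omega)$ and $f^n\in L^2(\Omega)$ for $1\le n\le N$, the functions $u^n\in H_0^1(\Omega)$, $1\le n\le N$, satisfy $$\langle D_2u^{n},w\rangle+\varepsilon\langle\nabla u^{n},\nabla w\rangle=\langle\kappa u^{n},w\rangle+\langle f^n,w\rangle\qquad\text{for all }w\in H_0^1(\Omega).$$ *)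

theory Defs
  imports "HOL-Analysis.Analysis"
begin

section \<open>Smooth functions and domains\<close>

text \<open>The notions below are meant for open \<open>S\<close>. A function is \<open>(k+1)\<close> times continuously
  differentiable iff it is differentiable and its partial derivatives are \<open>k\<close> times
  continuously differentiable.\<close>

primrec Ck_on :: "nat \<Rightarrow> 'a::euclidean_space set \<Rightarrow> ('a \<Rightarrow> real) \<Rightarrow> bool" where
  "Ck_on 0 S f \<longleftrightarrow> continuous_on S f"
| "Ck_on (Suc k) S f \<longleftrightarrow>
     (\<exists>f'. (\<forall>x\<in>S. (f has_derivative f' x) (at x)) \<and> (\<forall>i\<in>Basis. Ck_on k S (\<lambda>x. f' x i)))"

definition smooth_on :: "'a::euclidean_space set \<Rightarrow> ('a \<Rightarrow> real) \<Rightarrow> bool" where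
  "smooth_on S f \<longleftrightarrow> (\<forall>k. Ck_on k S f)"

text \<open>Near each boundary point, \<open>\<Omega>\<close> is the negativity set of a smooth local defining function
  with nonvanishing differential.\<close>

definition smooth_boundary :: "'a::euclidean_space set \<Rightarrow> bool" where
  "smooth_boundary \<Omega> \<longleftrightarrow>
     (\<forall>p\<in>frontier \<Omega>. \<exists>U \<rho>. open U \<and> p \<in> U \<and> smooth_on U \<rho> \<and>
        (\<forall>x\<in>U. frechet_derivative \<rho> (at x) \<noteq> (\<lambda>v. 0)) \<and> \<Omega> \<inter> U = {x\<in>U. \<rho> x < 0})"

section \<open>The spaces \<open>L\<^sup>2(\<Omega>)\<close> and \<open>H\<^sup>1\<^sub>0(\<Omega>)\<close>\<close>

text \<open>Elements of these spaces are represented by functions on the whole Euclidean space. Only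
  their values on \<open>\<Omega>\<close> matter, and functions that agree almost everywhere on \<open>\<Omega>\<close> are not
  identified. The target type is \<^typ>\<open>real\<close> for functions and the Euclidean space itself for
  gradients.\<close>

definition L2 :: "'a::euclidean_space set \<Rightarrow> ('a \<Rightarrow> 'b::euclidean_space) set" where
  "L2 \<Omega> = {f. f \<in> borel_measurable (lebesgue_on \<Omega>) \<and>
              integrable (lebesgue_on \<Omega>) (\<lambda>x. (norm (f x))\<^sup>2)}"

definition L2_inner ::
    "'a::euclidean_space set \<Rightarrow> ('a \<Rightarrow> 'b::euclidean_space) \<Rightarrow> ('a \<Rightarrow> 'b) \<Rightarrow> real" where
  "L2_inner \<Omega> f g = (\<integral>x. f x \<bullet> g x \<partial>lebesgue_on \<Omega>)"

definition L2_norm :: "'a::euclidean_space set \<Rightarrow> ('a \<Rightarrow> 'b::euclidean_space) \<Rightarrow> real" where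
  "L2_norm \<Omega> f = sqrt (L2_inner \<Omega> f f)"

definition test_functions :: "'a::euclidean_space set \<Rightarrow> ('a \<Rightarrow> real) set" where
  "test_functions \<Omega> = {\<phi>. smooth_on UNIV \<phi> \<and> compact (closure {x. \<phi> x \<noteq> 0}) \<and>
                          closure {x. \<phi> x \<noteq> 0} \<subseteq> \<Omega>}"

definition has_weak_gradient ::
    "'a::euclidean_space set \<Rightarrow> ('a \<Rightarrow> real) \<Rightarrow> ('a \<Rightarrow> 'a) \<Rightarrow> bool" where
  "has_weak_gradient \<Omega> u g \<longleftrightarrow> u \<in> L2 \<Omega> \<and> g \<in> L2 \<Omega> \<and>
     (\<forall>\<phi>\<in>test_functions \<Omega>. \<forall>i\<in>Basis.
        L2_inner \<Omega> u (\<lambda>x. frechet_derivative \<phi> (at x) i) = - L2_inner \<Omega> (\<lambda>x. g x \<bullet> i) \<phi>)"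

definition H1 :: "'a::euclidean_space set \<Rightarrow> ('a \<Rightarrow> real) set" where
  "H1 \<Omega> = {u. \<exists>g. has_weak_gradient \<Omega> u g}"

text \<open>For open \<open>\<Omega>\<close> the weak gradient is unique up to null sets, so integrals over \<open>\<Omega>\<close> do not
  depend on the representative chosen here.\<close>

definition weak_grad :: "'a::euclidean_space set \<Rightarrow> ('a \<Rightarrow> real) \<Rightarrow> 'a \<Rightarrow> 'a" where
  "weak_grad \<Omega> u = (SOME g. has_weak_gradient \<Omega> u g)"

definition H1_norm :: "'a::euclidean_space set \<Rightarrow> ('a \<Rightarrow> real) \<Rightarrow> real" where
  "H1_norm \<Omega> u = sqrt ((L2_norm \<Omega> u)\<^sup>2 + (L2_norm \<Omega> (weak_grad \<Omega> u))\<^sup>2)"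

text \<open>\<open>H\<^sup>1\<^sub>0(\<Omega>)\<close> is the closure of the test functions in \<open>H\<^sup>1(\<Omega>)\<close>.\<close>

definition H10 :: "'a::euclidean_space set \<Rightarrow> ('a \<Rightarrow> real) set" where
  "H10 \<Omega> = {u\<in>H1 \<Omega>. \<exists>\<phi>. (\<forall>m::nat. \<phi> m \<in> test_functions \<Omega>) \<and>
                        (\<lambda>m. H1_norm \<Omega> (\<lambda>x. u x - \<phi> m x)) \<longlonglongrightarrow> 0}"

section \<open>Time mesh and BDF2 kernels\<close>

definition time_mesh :: "(nat \<Rightarrow> real) \<Rightarrow> nat \<Rightarrow> real \<Rightarrow> bool" where
  "time_mesh t N T \<longleftrightarrow> t 0 = 0 \<and> (\<forall>k<N. t k < t (Suc k)) \<and> t N = T"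

definition step :: "(nat \<Rightarrow> real) \<Rightarrow> nat \<Rightarrow> real" where
  "step t k = t k - t (k - 1)"

definition max_step :: "(nat \<Rightarrow> real) \<Rightarrow> nat \<Rightarrow> real" where
  "max_step t N = Max (step t ` {1..N})"

definition step_ratio :: "(nat \<Rightarrow> real) \<Rightarrow> nat \<Rightarrow> real" where
  "step_ratio t k = step t k / step t (k - 1)"

text \<open>A family of kernels is a function \<open>b\<close> with \<open>b n j\<close> standing for \<open>b\<^sub>j\<close> with superscript
  \<open>(n)\<close>. Only the values with \<open>0 \<le> j < n\<close> are relevant.\<close>

definition bdf2_kernel :: "(nat \<Rightarrow> real) \<Rightarrow> nat \<Rightarrow> nat \<Rightarrow> real" where
  "bdf2_kernel t n j =
     (if n = 1 then (if j = 0 then 1 / step t 1 else 0)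
      else if j = 0 then (1 + 2 * step_ratio t n) / (step t n * (1 + step_ratio t n))
      else if j = 1 then - ((step_ratio t n)\<^sup>2 / (step t n * (1 + step_ratio t n)))
      else 0)"

definition kernels_psd :: "nat \<Rightarrow> (nat \<Rightarrow> nat \<Rightarrow> real) \<Rightarrow> bool" where
  "kernels_psd N b \<longleftrightarrow>
     (\<forall>n\<in>{1..N}. \<forall>w::nat \<Rightarrow> real. 0 \<le> (\<Sum>k=1..n. w k * (\<Sum>j=1..k. b k (k - j) * w j)))"

definition D2 :: "(nat \<Rightarrow> real) \<Rightarrow> (nat \<Rightarrow> 'a \<Rightarrow> real) \<Rightarrow> nat \<Rightarrow> 'a \<Rightarrow> real" where
  "D2 t v n x = (\<Sum>k=1..n. bdf2_kernel t n (n - k) * (v k x - v (k - 1) x))"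

text \<open>Discrete orthogonal convolution kernels of \<open>b\<close>. In the recursion the lower index is
  \<open>m = n - k\<close>; only \<open>m < n\<close> is relevant.\<close>

function doc_kernel :: "(nat \<Rightarrow> nat \<Rightarrow> real) \<Rightarrow> nat \<Rightarrow> nat \<Rightarrow> real" where
  "doc_kernel b n m =
     (if m = 0 then 1 / b n 0
      else (let k = n - m in
        - (1 / b k 0) * (\<Sum>j=k+1..n. doc_kernel b n (n - j) * b j (j - k))))"
  by auto
termination
  by (relation "Wellfounded.measure (\<lambda>(b, n, m). m)") auto

declare doc_kernel.simps [simp del]

section \<open>The adaptive BDF2 scheme\<close>

definition bdf2_scheme ::
    "'a::euclidean_space set \<Rightarrow> real \<Rightarrow> ('a \<Rightarrow> real) \<Rightarrow> (nat \<Rightarrow> real) \<Rightarrow> nat \<Rightarrow>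
     (nat \<Rightarrow> 'a \<Rightarrow> real) \<Rightarrow> (nat \<Rightarrow> 'a \<Rightarrow> real) \<Rightarrow> bool" where
  "bdf2_scheme \<Omega> \<epsilon> \<kappa> t N f u \<longleftrightarrow>
     (\<forall>n\<in>{1..N}. u n \<in> H10 \<Omega> \<and>
        (\<forall>w\<in>H10 \<Omega>.
           L2_inner \<Omega> (D2 t u n) w + \<epsilon> * L2_inner \<Omega> (weak_grad \<Omega> (u n)) (weak_grad \<Omega> w) =
           L2_inner \<Omega> (\<lambda>x. \<kappa> x * u n x) w + L2_inner \<Omega> (f n) w))"

end

theory Submission
  imports Defs
begin

text \<open>The DOC kernels form the inverse of the lower triangular matrix of the BDF2 kernels.
  Convolving the scheme with them turns \<open>D\<^sub>2 u\<^sup>j\<close> into \<open>u\<^sup>k - u\<^sup>k\<^sup>-\<^sup>1\<close>; testing with \<open>u\<^sup>k\<close> and summing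
  over \<open>k\<close>, the diffusion term has a sign because the inverse of a positive semi-definite matrix
  is positive semi-definite. Evaluating the resulting energy inequality at an index where
  \<open>\<parallel>u\<^sup>k\<parallel>\<close> is maximal allows one factor to be cancelled, and a discrete Gronwall argument
  finishes the proof, since the DOC kernels of row \<open>k\<close> are nonnegative with sum \<open>\<tau>\<^sub>k\<close>.\<close>

section \<open>Discrete orthogonal convolution kernels\<close>

text \<open>The recursion for \<open>doc_kernel\<close> is the vanishing of this sum solved for its
  term \<open>j = k\<close>. In terms of lower triangular matrices, the DOC kernels are a left
  inverse of \<open>b\<close>.\<close>

lemma doc_kernel_orthogonal:
  assumes "b k 0 \<noteq> 0" and "k \<le> n"
  shows "(\<Sum>j=k..n. doc_kernel b n (n - j) * b j (j - k)) = (if k = n then 1 else 0)"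
proof (cases "k = n")
  case True
  then show ?thesis using assms by (simp add: doc_kernel.simps[of b n 0])
next
  case False
  with assms have kn: "k < n" by simp
  have "doc_kernel b n (n - k) =
      - (1 / b k 0) * (\<Sum>j=k+1..n. doc_kernel b n (n - j) * b j (j - k))"
    using kn by (subst doc_kernel.simps) (simp add: Let_def)
  moreover have "(\<Sum>j=k..n. doc_kernel b n (n - j) * b j (j - k)) =
      doc_kernel b n (n - k) * b k 0 + (\<Sum>j=k+1..n. doc_kernel b n (n - j) * b j (j - k))"
    using kn by (subst sum.atLeast_Suc_atMost) auto
  ultimately show ?thesis using assms False by simp
qed

text \<open>This is the left inverse applied to a vector. With \<open>w\<close> the time steps it
  gives the row sums of the DOC kernels; with \<open>w\<close> the differences of inner products it
  collapses the tested \<open>D2\<close> terms to one difference.\<close>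

lemma doc_kernel_convolution:
  assumes "\<And>k. k \<in> {1..n} \<Longrightarrow> b k 0 \<noteq> 0" and "1 \<le> n"
  shows "(\<Sum>j=1..n. doc_kernel b n (n - j) * (\<Sum>k=1..j. b j (j - k) * w k)) = w n"
proof -
  \<comment> \<open>The triangle is written as a square with the condition \<open>k \<le> j\<close>,
    so that the order of summation can be exchanged.\<close>
  have "(\<Sum>j=1..n. doc_kernel b n (n - j) * (\<Sum>k=1..j. b j (j - k) * w k)) =
      (\<Sum>j=1..n. \<Sum>k | k \<in> {1..n} \<and> k \<le> j. doc_kernel b n (n - j) * (b j (j - k) * w k))"
    by (intro sum.cong refl) (auto simp: sum_distrib_left intro!: sum.cong)
  also have "\<dots> = (\<Sum>k=1..n. \<Sum>j | j \<in> {1..n} \<and> k \<le> j. doc_kernel b n (n - j) * (b j (j - k) * w k))"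
    by (rule sum.swap_restrict) auto
  also have "\<dots> = (\<Sum>k=1..n. w k * (\<Sum>j=k..n. doc_kernel b n (n - j) * b j (j - k)))"
    by (intro sum.cong refl) (auto simp: sum_distrib_left mult_ac intro!: sum.cong)
  also have "\<dots> = (\<Sum>k=1..n. w k * (if k = n then 1 else 0))"
    using assms by (intro sum.cong refl) (simp add: doc_kernel_orthogonal)
  also have "\<dots> = w n"
    using assms(2) by (simp add: if_distrib[of "(*) _"] cong: if_cong)
  finally show ?thesis .
qed

text \<open>Forward substitution: the diagonal is nonzero, so \<open>w\<close> can be extended by
  one entry that solves the new row without disturbing the earlier ones.\<close>

lemma convolution_solvable:
  fixes b :: "nat \<Rightarrow> nat \<Rightarrow> real" and g :: "nat \<Rightarrow> real"
  assumes "\<And>k. k \<in> {1..n} \<Longrightarrow> b k 0 \<noteq> 0"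
  shows "\<exists>w. \<forall>k\<in>{1..n}. (\<Sum>j=1..k. b k (k - j) * w j) = g k"
  using assms
proof (induction n)
  case 0
  then show ?case by simp
next
  case (Suc n)
  then obtain w where w: "\<forall>k\<in>{1..n}. (\<Sum>j=1..k. b k (k - j) * w j) = g k"
    by fastforce
  define x where "x = (g (Suc n) - (\<Sum>j=1..n. b (Suc n) (Suc n - j) * w j)) / b (Suc n) 0"
  have eq: "(\<Sum>j=1..k. c j * (w(Suc n := x)) j) = (\<Sum>j=1..k. c j * w j)" if "k \<le> n" for k c
    using that by (intro sum.cong) auto
  have "b (Suc n) 0 \<noteq> 0" using Suc.prems by simp
  then have "(\<Sum>j=1..Suc n. b (Suc n) (Suc n - j) * (w(Suc n := x)) j) = g (Suc n)"
    using eq[of n] by (simp add: x_def)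
  moreover have "(\<Sum>j=1..k. b k (k - j) * (w(Suc n := x)) j) = g k" if "k \<in> {1..n}" for k
    using that w eq[of k] by simp
  ultimately show ?case
    by (metis atLeastAtMostSuc_conv insert_iff le_add1 plus_1_eq_Suc)
qed

text \<open>Every \<open>g\<close> is the image of some \<open>w\<close> under \<open>b\<close>, and
  the DOC kernels map it back to \<open>w\<close>. The quadratic form of the inverse at
  \<open>g\<close> is therefore that of \<open>b\<close> at \<open>w\<close>.\<close>

lemma doc_kernel_psd:
  assumes psd: "kernels_psd N b" and b: "\<And>k. k \<in> {1..N} \<Longrightarrow> b k 0 \<noteq> 0"
  shows "kernels_psd N (doc_kernel b)"
  unfolding kernels_psd_def
proof (intro ballI allI)
  fix n and g :: "nat \<Rightarrow> real"
  assume n: "n \<in> {1..N}"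
  obtain w where w: "\<forall>k\<in>{1..n}. (\<Sum>j=1..k. b k (k - j) * w j) = g k"
    using convolution_solvable[of n b g] b n by force
  have "(\<Sum>j=1..k. doc_kernel b k (k - j) * g j) = w k" if k: "k \<in> {1..n}" for k
  proof -
    have "(\<Sum>j=1..k. doc_kernel b k (k - j) * g j) =
        (\<Sum>j=1..k. doc_kernel b k (k - j) * (\<Sum>l=1..j. b j (j - l) * w l))"
      using k w by (intro sum.cong) auto
    also have "\<dots> = w k"
      using k n b by (intro doc_kernel_convolution) auto
    finally show ?thesis .
  qed
  then have "(\<Sum>k=1..n. g k * (\<Sum>j=1..k. doc_kernel b k (k - j) * g j)) = (\<Sum>k=1..n. g k * w k)"
    by simp
  also have "\<dots> = (\<Sum>k=1..n. w k * (\<Sum>j=1..k. b k (k - j) * w j))"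
    using w by (simp add: mult.commute)
  finally show "0 \<le> (\<Sum>k=1..n. g k * (\<Sum>j=1..k. doc_kernel b k (k - j) * g j))"
    using psd n by (simp add: kernels_psd_def)
qed

lemma doc_kernel_nonneg:
  assumes "\<And>k. k \<in> {1..n} \<Longrightarrow> 0 < b k 0"
    and "\<And>k j. k \<in> {1..n} \<Longrightarrow> 1 \<le> j \<Longrightarrow> b k j \<le> 0"
    and "m < n"
  shows "0 \<le> doc_kernel b n m"
  using \<open>m < n\<close>
proof (induction m rule: less_induct)
  case (less m)
  show ?case
  proof (cases "m = 0")
    case True
    then show ?thesis using assms(1)[of n] less.prems by (simp add: doc_kernel.simps[of b n 0])
  next
    case False
    \<comment> \<open>In this range \<open>n - j < m\<close>, so the induction hypothesis applies,
      and \<open>j - (n - m)\<close> is at least \<open>1\<close>, so the factor from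
      \<open>b\<close> is off-diagonal.\<close>
    have "doc_kernel b n (n - j) * b j (j - (n - m)) \<le> 0" if "j \<in> {n - m + 1..n}" for j
      using that False less by (intro mult_nonneg_nonpos less.IH assms(2)) auto
    then have "(\<Sum>j=n-m+1..n. doc_kernel b n (n - j) * b j (j - (n - m))) \<le> 0"
      by (rule sum_nonpos)
    moreover have "0 < b (n - m) 0"
      using less.prems by (intro assms(1)) auto
    ultimately show ?thesis
      using False by (subst doc_kernel.simps) (simp add: Let_def divide_nonpos_pos)
  qed
qed

section \<open>The BDF2 kernels\<close>

lemma time_mesh_step_pos: "time_mesh t N T \<Longrightarrow> k \<in> {1..N} \<Longrightarrow> 0 < step t k"
  by (cases k) (auto simp: time_mesh_def step_def)

lemma time_mesh_sum_step: "time_mesh t N T \<Longrightarrow> (\<Sum>k=1..n. step t k) = t n"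
  by (induction n) (auto simp: step_def time_mesh_def)

lemma time_mesh_ratio_pos: "time_mesh t N T \<Longrightarrow> k \<in> {2..N} \<Longrightarrow> 0 < step_ratio t k"
  unfolding step_ratio_def by (intro divide_pos_pos time_mesh_step_pos) auto

lemma bdf2_kernel_diag_pos:
  assumes "time_mesh t N T" and "k \<in> {1..N}"
  shows "0 < bdf2_kernel t k 0"
  using time_mesh_step_pos[OF assms] time_mesh_ratio_pos[OF assms(1), of k] assms(2)
  by (auto simp: bdf2_kernel_def)

lemma bdf2_kernel_off_diag_nonpos:
  assumes "time_mesh t N T" and "k \<in> {1..N}" and "1 \<le> j"
  shows "bdf2_kernel t k j \<le> 0"
  using time_mesh_step_pos[OF assms(1,2)] time_mesh_ratio_pos[OF assms(1), of k] assms(2,3)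
  by (auto simp: bdf2_kernel_def)

lemma bdf2_kernel_convolution:
  assumes "2 \<le> n"
  shows "(\<Sum>k=1..n. bdf2_kernel t n (n - k) * w k) =
    bdf2_kernel t n 0 * w n + bdf2_kernel t n 1 * w (n - 1)"
proof -
  have "(\<Sum>k=1..n. bdf2_kernel t n (n - k) * w k) =
      (\<Sum>k\<in>{n - 1, n}. bdf2_kernel t n (n - k) * w k)"
    using assms by (intro sum.mono_neutral_right) (auto simp: bdf2_kernel_def)
  then show ?thesis using assms by auto
qed

text \<open>The left side is \<open>D2\<close> applied to the function \<open>t\<close> of time
  itself: the formula differentiates linear functions exactly.\<close>

lemma bdf2_kernel_convolution_step:
  assumes "time_mesh t N T" and "n \<in> {1..N}"
  shows "(\<Sum>k=1..n. bdf2_kernel t n (n - k) * step t k) = 1"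
proof (cases "n = 1")
  case True
  then show ?thesis using time_mesh_step_pos[OF assms] by (simp add: bdf2_kernel_def)
next
  case False
  define r where "r = step_ratio t n"
  have n: "n \<in> {2..N}" using False assms by auto
  have pos: "0 < r" "0 < step t n" "0 < step t (n - 1)"
    using n by (auto simp: r_def intro!: time_mesh_ratio_pos[OF assms(1)] time_mesh_step_pos[OF assms(1)])
  \<comment> \<open>Eliminating the current step reduces the off-diagonal contribution to
    \<open>r / (1 + r)\<close>.\<close>
  have s: "step t n = r * step t (n - 1)"
    using pos by (simp add: r_def step_ratio_def)
  have "(\<Sum>k=1..n. bdf2_kernel t n (n - k) * step t k) =
      (1 + 2 * r) / (step t n * (1 + r)) * step t n - r\<^sup>2 / (step t n * (1 + r)) * step t (n - 1)"
    using n by (subst bdf2_kernel_convolution) (auto simp: bdf2_kernel_def r_def)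
  also have "\<dots> = (1 + 2 * r) / (1 + r) - r / (1 + r)"
    using pos by (simp add: s power2_eq_square)
  also have "\<dots> = 1"
    using pos by (simp add: diff_divide_distrib[symmetric])
  finally show ?thesis .
qed

text \<open>The constant \<open>1\<close> is the BDF2 convolution of the steps, so convolving it
  with the DOC kernels returns the step.\<close>

lemma sum_doc_kernel_bdf2:
  assumes mesh: "time_mesh t N T" and k: "k \<in> {1..N}"
  shows "(\<Sum>j=1..k. doc_kernel (bdf2_kernel t) k (k - j)) = step t k"
proof -
  have "(\<Sum>j=1..k. doc_kernel (bdf2_kernel t) k (k - j)) =
      (\<Sum>j=1..k. doc_kernel (bdf2_kernel t) k (k - j) *
        (\<Sum>l=1..j. bdf2_kernel t j (j - l) * step t l))"
    using k bdf2_kernel_convolution_step[OF mesh] by (intro sum.cong) auto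
  also have "\<dots> = step t k"
  proof (rule doc_kernel_convolution)
    show "bdf2_kernel t l 0 \<noteq> 0" if "l \<in> {1..k}" for l
      using bdf2_kernel_diag_pos[OF mesh, of l] that k by auto
  qed (use k in auto)
  finally show ?thesis .
qed

text \<open>Here \<open>x\<close> and \<open>y\<close> stand for consecutive entries of
  \<open>w\<close>. After division by the current step, the inequality bounds the increment of
  \<open>c * w^2 / step\<close> by twice the contribution of one row to the quadratic form, which
  makes the estimate telescope.\<close>

lemma bdf2_ratio_inequality:
  fixes r R c x y :: real
  assumes R: "R = (3 + sqrt 17) / 2" "c = R / (1 + R)" and r: "0 < r" "r \<le> R"
  shows "c * x\<^sup>2 \<le> 2 * x * ((1 + 2 * r) / (1 + r) * x - r\<^sup>2 / (1 + r) * y) + c * r * y\<^sup>2"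
proof -
  have R2: "R\<^sup>2 = 3 * R + 2"
    by (simp add: R(1) power2_eq_square field_simps)
  have "1 \<le> sqrt 17" by simp
  then have R2ge: "2 \<le> R" by (simp add: R(1))
  then have Rpos: "0 < R" by simp
  \<comment> \<open>The threshold \<open>R\<close> is the positive root of \<open>R\<^sup>2 - 3 R - 2\<close>, which makes \<open>R - r\<close> a factor.\<close>
  have "(2 + 4 * r - r\<^sup>2) * (1 + R) - R * (1 + r) - (R - r) * ((1 + R) * r + (R - 2)) =
      (1 + r) * (3 * R + 2 - R\<^sup>2)"
    by (simp add: algebra_simps power2_eq_square)
  moreover have "0 \<le> (R - r) * ((1 + R) * r + (R - 2))"
    using r Rpos R2ge by (intro mult_nonneg_nonneg add_nonneg_nonneg) auto
  ultimately have 1: "R * (1 + r) \<le> (2 + 4 * r - r\<^sup>2) * (1 + R)"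
    using R2 by simp
  \<comment> \<open>This bound and \<open>c2\<close> both become equalities at \<open>r = R\<close>,
    which explains the choice of \<open>c\<close>.\<close>
  have c1: "c \<le> (2 + 4 * r - r\<^sup>2) / (1 + r)"
    using 1 r Rpos by (simp add: R(2) field_simps)
  have c2: "r / (1 + r) \<le> c"
    using r Rpos by (simp add: R(2) field_simps)
  have "c * x\<^sup>2 \<le> (2 + 4 * r - r\<^sup>2) / (1 + r) * x\<^sup>2"
    using c1 by (rule mult_right_mono) simp
  \<comment> \<open>The added square is chosen to produce the mixed term in
    \<open>x * y\<close>.\<close>
  also have "\<dots> \<le> (2 + 4 * r - r\<^sup>2) / (1 + r) * x\<^sup>2 + r\<^sup>2 / (1 + r) * (x - y)\<^sup>2"
    using r by simp
  also have "\<dots> = 2 * x * ((1 + 2 * r) / (1 + r) * x - r\<^sup>2 / (1 + r) * y) + r / (1 + r) * (r * y\<^sup>2)"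
    by (simp add: divide_inverse algebra_simps power2_eq_square)
  also have "r / (1 + r) * (r * y\<^sup>2) \<le> c * (r * y\<^sup>2)"
    using c2 r by (intro mult_right_mono) auto
  finally show ?thesis by (simp add: mult_ac)
qed

lemma bdf2_kernels_psd:
  assumes mesh: "time_mesh t N T"
    and ratio: "\<And>k. k \<in> {2..N} \<Longrightarrow> step_ratio t k \<le> (3 + sqrt 17) / 2"
  shows "kernels_psd N (bdf2_kernel t)"
  unfolding kernels_psd_def
proof (intro ballI allI)
  fix n and w :: "nat \<Rightarrow> real"
  assume n: "n \<in> {1..N}"
  define R :: real where "R = (3 + sqrt 17) / 2"
  define c where "c = R / (1 + R)"
  have Rpos: "0 < R" by (simp add: R_def add_pos_nonneg)
  then have c: "0 \<le> c" "c \<le> 1" by (auto simp: c_def)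
  define S where "S n = (\<Sum>k=1..n. w k * (\<Sum>j=1..k. bdf2_kernel t k (k - j) * w j))" for n
  \<comment> \<open>Nonnegativity of \<open>S\<close> is strengthened for the induction: the square
    of the last entry is kept as a reserve that pays for the off-diagonal term of the next
    row.\<close>
  have "c * (w (Suc m))\<^sup>2 / step t (Suc m) \<le> 2 * S (Suc m)" if "Suc m \<le> N" for m
    using that
  proof (induction m)
    case 0
    have "0 < step t 1" using time_mesh_step_pos[OF mesh, of 1] 0 by simp
    \<comment> \<open>The first row is BDF1, so twice its contribution is
      \<open>2 * (w 1)^2 / step t 1\<close>.\<close>
    moreover have "c * (w 1)\<^sup>2 \<le> 2 * (w 1)\<^sup>2"
      using c by (intro mult_right_mono) auto
    ultimately show ?case
      by (simp add: S_def bdf2_kernel_def power2_eq_square divide_right_mono)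
  next
    case (Suc m)
    define r where "r = step_ratio t (Suc (Suc m))"
    define p where "p = step t (Suc m)"
    define q where "q = step t (Suc (Suc m))"
    define x where "x = w (Suc (Suc m))"
    define y where "y = w (Suc m)"
    have pos: "0 < p" "0 < q" "0 < r"
      using Suc.prems time_mesh_step_pos[OF mesh] time_mesh_ratio_pos[OF mesh]
      by (auto simp: p_def q_def r_def)
    have q: "q = r * p"
      using pos by (simp add: r_def step_ratio_def p_def q_def)
    have "r \<le> R" using ratio Suc.prems by (simp add: r_def R_def)
    \<comment> \<open>Since \<open>q = r * p\<close>, division by \<open>q\<close> turns the last
      term into \<open>c * y^2 / p\<close>, which the induction hypothesis bounds.\<close>
    then have "c * x\<^sup>2 / q \<le>
        (2 * x * ((1 + 2 * r) / (1 + r) * x - r\<^sup>2 / (1 + r) * y) + c * r * y\<^sup>2) / q"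
      using pos by (intro divide_right_mono bdf2_ratio_inequality[OF R_def c_def]) auto
    also have "\<dots> = 2 * (x * ((1 + 2 * r) / (q * (1 + r)) * x - r\<^sup>2 / (q * (1 + r)) * y)) + c * y\<^sup>2 / p"
    proof -
      have "c * r * y\<^sup>2 / q = c * y\<^sup>2 / p"
        using pos by (simp add: q)
      moreover have "(1 + 2 * r) / (q * (1 + r)) * x - r\<^sup>2 / (q * (1 + r)) * y =
          ((1 + 2 * r) / (1 + r) * x - r\<^sup>2 / (1 + r) * y) / q"
        by (simp add: diff_divide_distrib mult.commute[of q])
      ultimately show ?thesis
        by (simp only: add_divide_distrib times_divide_eq_right mult.assoc)
    qed
    also have "(1 + 2 * r) / (q * (1 + r)) * x - r\<^sup>2 / (q * (1 + r)) * y =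
        (\<Sum>j=1..Suc (Suc m). bdf2_kernel t (Suc (Suc m)) (Suc (Suc m) - j) * w j)"
      by (subst bdf2_kernel_convolution) (auto simp: bdf2_kernel_def r_def q_def x_def y_def)
    also have "c * y\<^sup>2 / p \<le> 2 * S (Suc m)"
      using Suc by (simp add: y_def p_def)
    finally show ?case
      by (simp add: S_def x_def q_def algebra_simps)
  qed
  from this[of "n - 1"] have "c * (w n)\<^sup>2 / step t n \<le> 2 * S n"
    using n by auto
  moreover have "0 \<le> c * (w n)\<^sup>2 / step t n"
    using c time_mesh_step_pos[OF mesh n] by simp
  ultimately show "0 \<le> (\<Sum>k=1..n. w k * (\<Sum>j=1..k. bdf2_kernel t k (k - j) * w j))"
    by (simp add: S_def)
qed

section \<open>The inner product of \<open>L\<^sup>2(\<Omega>)\<close>\<close>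

lemma L2_inner_self_nonneg: "0 \<le> L2_inner \<Omega> f f"
  by (simp add: L2_inner_def)

lemma L2_norm_nonneg: "0 \<le> L2_norm \<Omega> f"
  by (simp add: L2_norm_def L2_inner_self_nonneg)

lemma L2_norm_power2: "(L2_norm \<Omega> f)\<^sup>2 = L2_inner \<Omega> f f"
  by (simp add: L2_norm_def L2_inner_self_nonneg)

lemma L2_integrable_inner:
  fixes f g :: "'a::euclidean_space \<Rightarrow> 'b::euclidean_space"
  assumes "f \<in> L2 \<Omega>" and "g \<in> L2 \<Omega>"
  shows "integrable (lebesgue_on \<Omega>) (\<lambda>x. f x \<bullet> g x)"
proof (rule Bochner_Integration.integrable_bound)
  show "integrable (lebesgue_on \<Omega>) (\<lambda>x. (norm (f x))\<^sup>2 + (norm (g x))\<^sup>2)"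
    using assms by (auto simp: L2_def)
  show "(\<lambda>x. f x \<bullet> g x) \<in> borel_measurable (lebesgue_on \<Omega>)"
    using assms by (auto simp: L2_def)
  have "\<bar>f x \<bullet> g x\<bar> \<le> (norm (f x))\<^sup>2 + (norm (g x))\<^sup>2" for x
  proof -
    have "\<bar>f x \<bullet> g x\<bar> \<le> norm (f x) * norm (g x)"
      by (rule Cauchy_Schwarz_ineq2)
    also have "\<dots> \<le> 2 * norm (f x) * norm (g x)"
      by simp
    also have "\<dots> \<le> (norm (f x))\<^sup>2 + (norm (g x))\<^sup>2"
      by (rule sum_squares_bound)
    finally show ?thesis .
  qed
  then show "AE x in lebesgue_on \<Omega>. norm (f x \<bullet> g x) \<le> norm ((norm (f x))\<^sup>2 + (norm (g x))\<^sup>2)"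
    by simp
qed

text \<open>The squared norm of \<open>f + s g\<close> is a nonnegative polynomial in
  \<open>s\<close>; evaluating it at a suitable \<open>s\<close> gives the discriminant
  inequality.\<close>

lemma L2_Cauchy_Schwarz:
  assumes f: "f \<in> L2 \<Omega>" and g: "g \<in> L2 \<Omega>"
  shows "\<bar>L2_inner \<Omega> f g\<bar> \<le> L2_norm \<Omega> f * L2_norm \<Omega> g"
proof -
  define A where "A = L2_inner \<Omega> f f"
  define B where "B = L2_inner \<Omega> f g"
  define C where "C = L2_inner \<Omega> g g"
  note int = L2_integrable_inner[OF f f] L2_integrable_inner[OF f g] L2_integrable_inner[OF g g]
  have quad: "0 \<le> A + 2 * s * B + s\<^sup>2 * C" for s
  proof -
    have "0 \<le> (\<integral>x. (f x + s *\<^sub>R g x) \<bullet> (f x + s *\<^sub>R g x) \<partial>lebesgue_on \<Omega>)"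
      by simp
    also have "\<dots> = (\<integral>x. f x \<bullet> f x + 2 * s * (f x \<bullet> g x) + s\<^sup>2 * (g x \<bullet> g x) \<partial>lebesgue_on \<Omega>)"
      by (simp add: inner_add_left inner_add_right inner_commute power2_eq_square algebra_simps)
    also have "\<dots> = A + 2 * s * B + s\<^sup>2 * C"
      using int by (simp add: A_def B_def C_def L2_inner_def)
    finally show ?thesis .
  qed
  have "0 \<le> C" by (simp add: C_def L2_inner_self_nonneg)
  have "B\<^sup>2 \<le> A * C"
  proof (cases "C = 0")
    case True
    have "B = 0"
    proof (rule ccontr)
      assume "B \<noteq> 0"
      \<comment> \<open>With \<open>C = 0\<close> the polynomial is affine in \<open>s\<close>, and
        at this point its value is \<open>-1\<close>.\<close>
      then show False
        using quad[of "- (A + 1) / (2 * B)"] True by (simp add: field_simps)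
    qed
    then show ?thesis using True by simp
  next
    case False
    \<comment> \<open>The point \<open>- B / C\<close> minimises the polynomial, with value
      \<open>A - B^2 / C\<close>.\<close>
    then show ?thesis
      using quad[of "- B / C"] \<open>0 \<le> C\<close> by (simp add: field_simps power2_eq_square)
  qed
  then have "sqrt (B\<^sup>2) \<le> sqrt (A * C)"
    by (rule real_sqrt_le_mono)
  then show ?thesis
    by (simp add: A_def B_def C_def L2_norm_def real_sqrt_mult)
qed

lemma L2_abs: "f \<in> L2 \<Omega> \<Longrightarrow> (\<lambda>x. \<bar>f x :: real\<bar>) \<in> L2 \<Omega>"
  by (auto simp: L2_def)

lemma L2_inner_mult_le:
  assumes f: "f \<in> L2 \<Omega>" and g: "g \<in> L2 \<Omega>" and \<kappa>: "\<forall>x\<in>\<Omega>. \<bar>\<kappa> x\<bar> \<le> K" and "0 \<le> K"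
  shows "L2_inner \<Omega> (\<lambda>x. \<kappa> x * f x) g \<le> K * (L2_norm \<Omega> f * L2_norm \<Omega> g)"
proof -
  let ?M = "lebesgue_on \<Omega>"
  have int: "integrable ?M (\<lambda>x. K * (\<bar>f x\<bar> \<bullet> \<bar>g x\<bar>))"
    using L2_integrable_inner[OF L2_abs[OF f] L2_abs[OF g]] by simp
  have "L2_inner \<Omega> (\<lambda>x. \<kappa> x * f x) g \<le> norm (\<integral>x. (\<kappa> x * f x) \<bullet> g x \<partial>?M)"
    by (simp add: L2_inner_def)
  also have "\<dots> \<le> (\<integral>x. norm ((\<kappa> x * f x) \<bullet> g x) \<partial>?M)"
    by (rule integral_norm_bound)
  \<comment> \<open>A non-integrable left integrand has integral \<open>0\<close>, so the estimate
    rests on the integrable nonnegative majorant alone.\<close>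
  also have "\<dots> \<le> (\<integral>x. K * (\<bar>f x\<bar> \<bullet> \<bar>g x\<bar>) \<partial>?M)"
    using int
  proof (rule integral_mono')
    show "norm ((\<kappa> x * f x) \<bullet> g x) \<le> K * (\<bar>f x\<bar> \<bullet> \<bar>g x\<bar>)" if "x \<in> space ?M" for x
      using that \<kappa> by (auto simp: abs_mult mult.assoc intro!: mult_right_mono)
  qed (use \<open>0 \<le> K\<close> in auto)
  also have "\<dots> = K * L2_inner \<Omega> (\<lambda>x. \<bar>f x\<bar>) (\<lambda>x. \<bar>g x\<bar>)"
    by (simp add: L2_inner_def)
  also have "L2_inner \<Omega> (\<lambda>x. \<bar>f x\<bar>) (\<lambda>x. \<bar>g x\<bar>) \<le> L2_norm \<Omega> f * L2_norm \<Omega> g"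
    using L2_Cauchy_Schwarz[OF L2_abs[OF f] L2_abs[OF g]] by (simp add: L2_norm_def L2_inner_def)
  finally show ?thesis
    using \<open>0 \<le> K\<close> by (simp add: mult_left_mono)
qed

text \<open>At a fixed point \<open>x\<close> the scalar property is applied to each coordinate of
  the vectors \<open>G k x\<close>; summing over the basis and integrating preserves the sign. The
  lemma serves for the gradients in the diffusion term.\<close>

lemma kernels_psd_L2_inner:
  fixes G :: "nat \<Rightarrow> 'a::euclidean_space \<Rightarrow> 'b::euclidean_space"
  assumes psd: "kernels_psd N b" and n: "n \<in> {1..N}"
    and G: "\<And>k. k \<in> {1..n} \<Longrightarrow> G k \<in> L2 \<Omega>"
  shows "0 \<le> (\<Sum>k=1..n. \<Sum>j=1..k. b k (k - j) * L2_inner \<Omega> (G j) (G k))"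
proof -
  have int: "integrable (lebesgue_on \<Omega>) (\<lambda>x. G j x \<bullet> G k x)" if "k \<in> {1..n}" "j \<in> {1..k}" for j k
    using that by (intro L2_integrable_inner G) auto
  have "0 \<le> (\<Sum>k=1..n. \<Sum>j=1..k. b k (k - j) * (G j x \<bullet> G k x))" for x
  proof -
    have "(\<Sum>k=1..n. \<Sum>j=1..k. b k (k - j) * (G j x \<bullet> G k x)) =
        (\<Sum>k=1..n. \<Sum>j=1..k. \<Sum>i\<in>Basis. b k (k - j) * ((G j x \<bullet> i) * (G k x \<bullet> i)))"
      by (subst euclidean_inner) (simp add: sum_distrib_left)
    also have "\<dots> = (\<Sum>k=1..n. \<Sum>i\<in>Basis. \<Sum>j=1..k. b k (k - j) * ((G j x \<bullet> i) * (G k x \<bullet> i)))"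
      by (intro sum.cong refl sum.swap)
    also have "\<dots> = (\<Sum>i\<in>Basis. \<Sum>k=1..n. \<Sum>j=1..k. b k (k - j) * ((G j x \<bullet> i) * (G k x \<bullet> i)))"
      by (rule sum.swap)
    also have "\<dots> = (\<Sum>i\<in>Basis. \<Sum>k=1..n. (G k x \<bullet> i) * (\<Sum>j=1..k. b k (k - j) * (G j x \<bullet> i)))"
      by (simp add: sum_distrib_left mult_ac)
    also have "\<dots> \<ge> 0"
      using psd n by (intro sum_nonneg[of Basis]) (simp add: kernels_psd_def)
    finally show ?thesis .
  qed
  then have "0 \<le> (\<integral>x. (\<Sum>k=1..n. \<Sum>j=1..k. b k (k - j) * (G j x \<bullet> G k x)) \<partial>lebesgue_on \<Omega>)"
    by (rule Bochner_Integration.integral_nonneg)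
  also have "\<dots> = (\<Sum>k=1..n. (\<integral>x. (\<Sum>j=1..k. b k (k - j) * (G j x \<bullet> G k x)) \<partial>lebesgue_on \<Omega>))"
    using int by (intro Bochner_Integration.integral_sum Bochner_Integration.integrable_sum) auto
  also have "\<dots> = (\<Sum>k=1..n. \<Sum>j=1..k. (\<integral>x. b k (k - j) * (G j x \<bullet> G k x) \<partial>lebesgue_on \<Omega>))"
    using int by (intro sum.cong refl Bochner_Integration.integral_sum) auto
  finally show ?thesis
    by (simp add: L2_inner_def)
qed

text \<open>Linearity turns the tested time derivative into a scalar convolution, the form that the
  DOC kernels invert.\<close>

lemma L2_inner_D2:
  assumes u: "\<And>k. k \<le> n \<Longrightarrow> u k \<in> L2 \<Omega>" and w: "w \<in> L2 \<Omega>"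
  shows "L2_inner \<Omega> (D2 t u n) w =
    (\<Sum>k=1..n. bdf2_kernel t n (n - k) * (L2_inner \<Omega> (u k) w - L2_inner \<Omega> (u (k - 1)) w))"
proof -
  have int: "integrable (lebesgue_on \<Omega>) (\<lambda>x. u k x * w x)" if "k \<le> n" for k
    using L2_integrable_inner[OF u[OF that] w] by simp
  have "L2_inner \<Omega> (D2 t u n) w =
      (\<integral>x. (\<Sum>k=1..n. bdf2_kernel t n (n - k) * (u k x * w x - u (k - 1) x * w x)) \<partial>lebesgue_on \<Omega>)"
    by (simp add: L2_inner_def D2_def sum_distrib_right left_diff_distrib mult.assoc)
  also have "\<dots> = (\<Sum>k=1..n. (\<integral>x. bdf2_kernel t n (n - k) * (u k x * w x - u (k - 1) x * w x) \<partial>lebesgue_on \<Omega>))"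
    using int by (intro Bochner_Integration.integral_sum) auto
  also have "\<dots> = (\<Sum>k=1..n. bdf2_kernel t n (n - k) * (L2_inner \<Omega> (u k) w - L2_inner \<Omega> (u (k - 1)) w))"
    using int by (intro sum.cong refl) (auto simp: L2_inner_def)
  finally show ?thesis .
qed

lemma H10_imp_L2: "u \<in> H10 \<Omega> \<Longrightarrow> u \<in> L2 \<Omega>"
  by (auto simp: H10_def H1_def has_weak_gradient_def)

lemma weak_grad_L2: "u \<in> H10 \<Omega> \<Longrightarrow> weak_grad \<Omega> u \<in> L2 \<Omega>"
  unfolding weak_grad_def
  by (rule someI2_ex[where Q = "\<lambda>g. g \<in> L2 \<Omega>"]) (auto simp: H10_def H1_def has_weak_gradient_def)

section \<open>Energy inequality and Gronwall argument\<close>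

text \<open>The accumulated right side grows at index \<open>k\<close> by a factor of at most
  \<open>1 + s k \<le> exp (s k)\<close>. Bounding this sum rather than \<open>a\<close> lets the
  exponent at a given index involve earlier steps only.\<close>

lemma discrete_gronwall:
  fixes a s :: "nat \<Rightarrow> real"
  assumes a: "\<And>m. m \<in> {1..n} \<Longrightarrow> a m \<le> B + (\<Sum>k=1..m-1. s k * a k)"
    and s: "\<And>k. k \<in> {1..n} \<Longrightarrow> 0 \<le> s k" and "0 \<le> B"
  shows "B + (\<Sum>k=1..n. s k * a k) \<le> B * exp (\<Sum>k=1..n. s k)"
  using a s
proof (induction n)
  case 0
  then show ?case by simp
next
  case (Suc n)
  define S where "S = B + (\<Sum>k=1..n. s k * a k)"
  have s: "0 \<le> s (Suc n)" using Suc.prems by simp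
  have IH: "S \<le> B * exp (\<Sum>k=1..n. s k)"
    unfolding S_def using Suc.prems by (intro Suc.IH) auto
  have "B + (\<Sum>k=1..Suc n. s k * a k) = S + s (Suc n) * a (Suc n)"
    by (simp add: S_def)
  also have "\<dots> \<le> S + s (Suc n) * S"
    using Suc.prems(1)[of "Suc n"] s by (intro add_left_mono mult_left_mono) (auto simp: S_def)
  also have "\<dots> = (1 + s (Suc n)) * S"
    by (simp add: algebra_simps)
  also have "\<dots> \<le> (1 + s (Suc n)) * (B * exp (\<Sum>k=1..n. s k))"
    using s IH by (intro mult_left_mono) auto
  also have "\<dots> \<le> exp (s (Suc n)) * (B * exp (\<Sum>k=1..n. s k))"
    using \<open>0 \<le> B\<close> by (intro mult_right_mono exp_ge_add_one_self) auto
  finally show ?case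
    by (simp add: exp_add mult_ac)
qed

text \<open>In the reaction term only \<open>a j\<close> is replaced by the maximum: the sum over
  \<open>j\<close> then collapses to the row sum \<open>s k\<close>, and \<open>a k\<close> survives
  for the Gronwall argument. In the source term \<open>a k\<close> is replaced instead.\<close>

lemma energy_imp_linear_bound:
  fixes a \<phi> s :: "nat \<Rightarrow> real" and \<theta> :: "nat \<Rightarrow> nat \<Rightarrow> real"
  assumes energy: "\<And>m. m \<le> n \<Longrightarrow> (a m)\<^sup>2 \<le> (a 0)\<^sup>2 +
      2 * (\<Sum>k=1..m. \<Sum>j=1..k. \<theta> k (k - j) * (K * (a j * a k) + \<phi> j * a k))"
    and a: "\<And>k. 0 \<le> a k" and \<phi>: "\<And>k. 0 \<le> \<phi> k" and K: "0 \<le> K"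
    and \<theta>: "\<And>k j. k \<in> {1..n} \<Longrightarrow> j \<in> {1..k} \<Longrightarrow> 0 \<le> \<theta> k (k - j)"
    and s: "\<And>k. k \<in> {1..n} \<Longrightarrow> (\<Sum>j=1..k. \<theta> k (k - j)) = s k"
  shows "a n \<le> a 0 + 2 * K * (\<Sum>k=1..n. s k * a k) + 2 * (\<Sum>k=1..n. \<Sum>j=1..k. \<theta> k (k - j) * \<phi> j)"
proof -
  have s0: "0 \<le> s k" if "k \<in> {1..n}" for k
    using that \<theta> by (subst s[symmetric]) (auto intro!: sum_nonneg)
  define F where "F m = (\<Sum>k=1..m. \<Sum>j=1..k. \<theta> k (k - j) * \<phi> j)" for m
  define Q where "Q m = (\<Sum>k=1..m. s k * a k)" for m
  \<comment> \<open>Index \<open>0\<close> takes part in the maximum, because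
    \<open>a 0 \<le> a m\<close> is needed to extract a factor \<open>a m\<close> from the initial
    term.\<close>
  have "\<exists>m\<in>{..n}. \<forall>k\<in>{..n}. a k \<le> a m"
    using Max_in[of "a ` {..n}"] Max_ge[of "a ` {..n}"] by fastforce
  then obtain m where m: "m \<le> n" and max: "\<And>k. k \<le> n \<Longrightarrow> a k \<le> a m"
    by auto
  have FQ: "F m \<le> F n" "Q m \<le> Q n"
    unfolding F_def Q_def using m a \<phi> \<theta> s0 by (intro sum_mono2; force intro!: sum_nonneg)+
  have "a m \<le> a 0 + 2 * K * Q m + 2 * F m"
  proof (cases "a m = 0")
    \<comment> \<open>There is no factor to cancel here, but the right side is nonnegative.\<close>
    case True
    have "0 \<le> Q m" "0 \<le> F m"
      unfolding F_def Q_def using m a \<phi> \<theta> s0 by (auto intro!: sum_nonneg)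
    then show ?thesis using True a[of 0] K by simp
  next
    case False
    then have pos: "0 < a m" using a[of m] by simp
    have "(\<Sum>j=1..k. \<theta> k (k - j) * (K * (a j * a k) + \<phi> j * a k)) \<le>
        a m * (K * (s k * a k) + (\<Sum>j=1..k. \<theta> k (k - j) * \<phi> j))" if k: "k \<in> {1..m}" for k
    proof -
      have "(\<Sum>j=1..k. \<theta> k (k - j) * (K * (a j * a k) + \<phi> j * a k)) \<le>
          (\<Sum>j=1..k. \<theta> k (k - j) * (K * (a m * a k) + \<phi> j * a m))"
        using k m a \<phi> K \<theta> max by (intro sum_mono mult_left_mono add_mono mult_right_mono) auto
      also have "\<dots> = (\<Sum>j=1..k. \<theta> k (k - j)) * (K * (a m * a k)) + a m * (\<Sum>j=1..k. \<theta> k (k - j) * \<phi> j)"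
        by (simp add: sum_distrib_left sum_distrib_right distrib_left sum.distrib mult_ac)
      also have "(\<Sum>j=1..k. \<theta> k (k - j)) = s k"
        using k m by (intro s) auto
      finally show ?thesis by (simp add: algebra_simps)
    qed
    then have "(\<Sum>k=1..m. \<Sum>j=1..k. \<theta> k (k - j) * (K * (a j * a k) + \<phi> j * a k)) \<le>
        (\<Sum>k=1..m. a m * (K * (s k * a k) + (\<Sum>j=1..k. \<theta> k (k - j) * \<phi> j)))"
      by (rule sum_mono)
    also have "\<dots> = a m * (K * Q m + F m)"
      by (simp add: Q_def F_def sum_distrib_left sum.distrib[symmetric] distrib_left)
    finally have "(a m)\<^sup>2 \<le> (a 0)\<^sup>2 + 2 * (a m * (K * Q m + F m))"
      using energy[OF m] by linarith
    also have "(a 0)\<^sup>2 \<le> a m * a 0"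
      unfolding power2_eq_square using max[of 0] a[of 0] by (intro mult_right_mono) auto
    finally have "a m * a m \<le> a m * (a 0 + 2 * K * Q m + 2 * F m)"
      by (simp add: power2_eq_square algebra_simps)
    then show ?thesis using pos by simp
  qed
  moreover have "2 * K * Q m \<le> 2 * K * Q n"
    using FQ K by (intro mult_left_mono) auto
  ultimately show ?thesis
    using max[of n] FQ(1) unfolding F_def Q_def by linarith
qed

text \<open>The case \<open>m = 0\<close> is included because the maximal norm may be attained by
  the initial value.\<close>

lemma bdf2_energy:
  fixes \<Omega> :: "'a::euclidean_space set"
  assumes "0 \<le> \<epsilon>" and "0 \<le> K" and \<kappa>: "\<forall>x\<in>\<Omega>. \<bar>\<kappa> x\<bar> \<le> K"
    and mesh: "time_mesh t N T" and u0: "u 0 \<in> L2 \<Omega>" and f: "\<forall>n\<in>{1..N}. f n \<in> L2 \<Omega>"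
    and scheme: "bdf2_scheme \<Omega> \<epsilon> \<kappa> t N f u"
    and psd: "kernels_psd N (bdf2_kernel t)" and m: "m \<le> N"
  shows "(L2_norm \<Omega> (u m))\<^sup>2 \<le> (L2_norm \<Omega> (u 0))\<^sup>2 +
      2 * (\<Sum>k=1..m. \<Sum>j=1..k. doc_kernel (bdf2_kernel t) k (k - j) *
        (K * (L2_norm \<Omega> (u j) * L2_norm \<Omega> (u k)) + L2_norm \<Omega> (f j) * L2_norm \<Omega> (u k)))"
    (is "_ \<le> _ + 2 * (\<Sum>k=1..m. \<Sum>j=1..k. ?\<theta> k (k - j) * ?R j k)")
proof -
  define G where "G k = weak_grad \<Omega> (u k)" for k
  have H10: "u k \<in> H10 \<Omega>" if "k \<in> {1..N}" for k
    using scheme that by (auto simp: bdf2_scheme_def)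
  have L2: "u k \<in> L2 \<Omega>" if "k \<le> N" for k
    using u0 H10_imp_L2[OF H10[of k]] that by (cases "k = 0") auto
  have diag: "bdf2_kernel t k 0 \<noteq> 0" if "k \<in> {1..N}" for k
    using bdf2_kernel_diag_pos[OF mesh that] by simp
  have \<theta>: "0 \<le> ?\<theta> k (k - j)" if "k \<in> {1..N}" "j \<in> {1..k}" for j k
    using that bdf2_kernel_diag_pos[OF mesh] bdf2_kernel_off_diag_nonpos[OF mesh]
    by (intro doc_kernel_nonneg) auto
  \<comment> \<open>The diffusion term stays in this estimate, since the available sign information
    concerns its sum over \<open>k\<close>.\<close>
  have step: "((L2_norm \<Omega> (u k))\<^sup>2 - (L2_norm \<Omega> (u (k - 1)))\<^sup>2) / 2 \<le>
      (\<Sum>j=1..k. ?\<theta> k (k - j) * ?R j k) - \<epsilon> * (\<Sum>j=1..k. ?\<theta> k (k - j) * L2_inner \<Omega> (G j) (G k))"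
    if k: "k \<in> {1..N}" for k
  proof -
    have "\<bar>L2_inner \<Omega> (u (k - 1)) (u k)\<bar> \<le> L2_norm \<Omega> (u (k - 1)) * L2_norm \<Omega> (u k)"
      using k by (intro L2_Cauchy_Schwarz L2) auto
    moreover have "2 * L2_norm \<Omega> (u (k - 1)) * L2_norm \<Omega> (u k) \<le>
        (L2_norm \<Omega> (u (k - 1)))\<^sup>2 + (L2_norm \<Omega> (u k))\<^sup>2"
      by (rule sum_squares_bound)
    ultimately have "((L2_norm \<Omega> (u k))\<^sup>2 - (L2_norm \<Omega> (u (k - 1)))\<^sup>2) / 2 \<le>
        L2_inner \<Omega> (u k) (u k) - L2_inner \<Omega> (u (k - 1)) (u k)"
      unfolding L2_norm_power2[symmetric] by (simp add: field_simps)
    \<comment> \<open>Orthogonality is used backwards, with the test function \<open>u k\<close>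
      fixed while the time levels \<open>l\<close> vary.\<close>
    also have "\<dots> = (\<Sum>j=1..k. ?\<theta> k (k - j) * (\<Sum>l=1..j. bdf2_kernel t j (j - l) *
        (L2_inner \<Omega> (u l) (u k) - L2_inner \<Omega> (u (l - 1)) (u k))))"
      using k diag by (intro doc_kernel_convolution[symmetric]) auto
    also have "\<dots> = (\<Sum>j=1..k. ?\<theta> k (k - j) * L2_inner \<Omega> (D2 t u j) (u k))"
      using k L2 by (intro sum.cong refl) (simp add: L2_inner_D2)
    also have "\<dots> \<le> (\<Sum>j=1..k. ?\<theta> k (k - j) * (?R j k - \<epsilon> * L2_inner \<Omega> (G j) (G k)))"
    proof (intro sum_mono mult_left_mono)
      fix j assume j: "j \<in> {1..k}"
      \<comment> \<open>The scheme at level \<open>j\<close> is tested with \<open>u k\<close>, not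
        with \<open>u j\<close>.\<close>
      have "L2_inner \<Omega> (D2 t u j) (u k) + \<epsilon> * L2_inner \<Omega> (G j) (G k) =
          L2_inner \<Omega> (\<lambda>x. \<kappa> x * u j x) (u k) + L2_inner \<Omega> (f j) (u k)"
        using scheme j k H10 by (auto simp: bdf2_scheme_def G_def)
      moreover have "L2_inner \<Omega> (\<lambda>x. \<kappa> x * u j x) (u k) \<le> K * (L2_norm \<Omega> (u j) * L2_norm \<Omega> (u k))"
        using j k L2 \<kappa> \<open>0 \<le> K\<close> by (intro L2_inner_mult_le) auto
      moreover have "\<bar>L2_inner \<Omega> (f j) (u k)\<bar> \<le> L2_norm \<Omega> (f j) * L2_norm \<Omega> (u k)"
        using j k L2 f by (intro L2_Cauchy_Schwarz) auto
      ultimately show "L2_inner \<Omega> (D2 t u j) (u k) \<le> ?R j k - \<epsilon> * L2_inner \<Omega> (G j) (G k)"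
        by linarith
    qed (use k \<theta> in auto)
    also have "\<dots> = (\<Sum>j=1..k. ?\<theta> k (k - j) * ?R j k) -
        \<epsilon> * (\<Sum>j=1..k. ?\<theta> k (k - j) * L2_inner \<Omega> (G j) (G k))"
      by (simp only: right_diff_distrib sum_subtractf sum_distrib_left mult.left_commute[of \<epsilon>])
    finally show ?thesis .
  qed
  show ?thesis
  proof (cases "m = 0")
    case False
    with m have m: "m \<in> {1..N}" by simp
    have "((L2_norm \<Omega> (u m))\<^sup>2 - (L2_norm \<Omega> (u 0))\<^sup>2) / 2 =
        (\<Sum>k=1..m. ((L2_norm \<Omega> (u k))\<^sup>2 - (L2_norm \<Omega> (u (k - 1)))\<^sup>2) / 2)"
      by (induction m) (auto simp: field_simps)
    also have "\<dots> \<le> (\<Sum>k=1..m. (\<Sum>j=1..k. ?\<theta> k (k - j) * ?R j k) -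
        \<epsilon> * (\<Sum>j=1..k. ?\<theta> k (k - j) * L2_inner \<Omega> (G j) (G k)))"
      using m by (intro sum_mono step) auto
    also have "\<dots> = (\<Sum>k=1..m. \<Sum>j=1..k. ?\<theta> k (k - j) * ?R j k) -
        \<epsilon> * (\<Sum>k=1..m. \<Sum>j=1..k. ?\<theta> k (k - j) * L2_inner \<Omega> (G j) (G k))"
      by (simp only: sum_subtractf sum_distrib_left)
    also have "\<dots> \<le> (\<Sum>k=1..m. \<Sum>j=1..k. ?\<theta> k (k - j) * ?R j k)"
    proof -
      have "0 \<le> (\<Sum>k=1..m. \<Sum>j=1..k. ?\<theta> k (k - j) * L2_inner \<Omega> (G j) (G k))"
        using m H10 by (intro kernels_psd_L2_inner[OF doc_kernel_psd[OF psd diag]])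
          (auto simp: G_def intro!: weak_grad_L2)
      then show ?thesis using \<open>0 \<le> \<epsilon>\<close> by simp
    qed
    finally show ?thesis by simp
  qed simp
qed

theorem theorem3p1:
  fixes \<Omega> :: "'a::euclidean_space set"
    and \<epsilon> \<kappa>s T :: real
    and \<kappa> :: "'a \<Rightarrow> real"
    and t :: "nat \<Rightarrow> real"
    and N :: nat
    and u f :: "nat \<Rightarrow> 'a \<Rightarrow> real"
  assumes "open \<Omega>" and "\<Omega> \<noteq> {}" and "bounded \<Omega>" and "convex \<Omega>" and "smooth_boundary \<Omega>"
    and "\<epsilon> > 0"
    and "smooth_on \<Omega> \<kappa>" and "\<kappa>s > 0" and "\<forall>x\<in>\<Omega>. \<bar>\<kappa> x\<bar> \<le> \<kappa>s"
    and "T > 0" and "time_mesh t N T"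
    and "u 0 \<in> L2 \<Omega>" and "\<forall>n\<in>{1..N}. f n \<in> L2 \<Omega>"
    and "bdf2_scheme \<Omega> \<epsilon> \<kappa> t N f u"
    and "kernels_psd N (bdf2_kernel t) \<or>
         (\<forall>k\<in>{2..N}. 0 < step_ratio t k \<and> step_ratio t k \<le> (3 + sqrt 17) / 2)"
    and "max_step t N \<le> 1 / (4 * \<kappa>s)"
  shows "\<forall>n\<in>{1..N}. L2_norm \<Omega> (u n) \<le>
           2 * exp (4 * \<kappa>s * t (n - 1)) *
             (L2_norm \<Omega> (u 0) +
              2 * (\<Sum>k=1..n. \<Sum>j=1..k. doc_kernel (bdf2_kernel t) k (k - j) * L2_norm \<Omega> (f j)))"
proof
  note \<kappa>s = assms(8) and \<kappa> = assms(9) and mesh = assms(11)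
    and scheme = assms(14)
  fix n assume n: "n \<in> {1..N}"
  define a where "a k = L2_norm \<Omega> (u k)" for k
  define \<theta> where "\<theta> = doc_kernel (bdf2_kernel t)"
  define F where "F m = (\<Sum>k=1..m. \<Sum>j=1..k. \<theta> k (k - j) * L2_norm \<Omega> (f j))" for m
  have psd: "kernels_psd N (bdf2_kernel t)"
    using assms(15) bdf2_kernels_psd[OF mesh] by blast
  have a0: "0 \<le> a k" for k
    by (simp add: a_def L2_norm_nonneg)
  have \<theta>0: "0 \<le> \<theta> k (k - j)" if "k \<in> {1..N}" "j \<in> {1..k}" for j k
    unfolding \<theta>_def
    using that bdf2_kernel_diag_pos[OF mesh] bdf2_kernel_off_diag_nonpos[OF mesh]
    by (intro doc_kernel_nonneg) auto
  have s0: "0 < step t k" if "k \<in> {1..N}" for k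
    using time_mesh_step_pos[OF mesh that] .
  \<comment> \<open>Monotonicity makes the constant \<open>B\<close> below independent of
    \<open>m\<close>, as the Gronwall lemma requires.\<close>
  have F_mono: "F m \<le> F n" if "m \<in> {1..n}" for m
    unfolding F_def using that n \<theta>0
    by (intro sum_mono2) (auto intro!: sum_nonneg mult_nonneg_nonneg L2_norm_nonneg)
  have bound: "a m \<le> a 0 + 2 * \<kappa>s * (\<Sum>k=1..m. step t k * a k) + 2 * F m" if m: "m \<in> {1..n}" for m
    unfolding F_def
  proof (rule energy_imp_linear_bound)
    show "(a l)\<^sup>2 \<le> (a 0)\<^sup>2 + 2 * (\<Sum>k=1..l. \<Sum>j=1..k. \<theta> k (k - j) *
        (\<kappa>s * (a j * a k) + L2_norm \<Omega> (f j) * a k))" if "l \<le> m" for l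
      unfolding a_def \<theta>_def
      using that m n \<kappa>s assms(6) psd by (intro bdf2_energy[OF _ _ \<kappa> mesh assms(12,13) scheme]) auto
    show "(\<Sum>j=1..k. \<theta> k (k - j)) = step t k" if "k \<in> {1..m}" for k
      unfolding \<theta>_def using that m n by (intro sum_doc_kernel_bdf2[OF mesh]) auto
  qed (use \<kappa>s m n a0 \<theta>0 L2_norm_nonneg in auto)
  define B where "B = 2 * (a 0 + 2 * F n)"
  have rec: "a m \<le> B + (\<Sum>k=1..m-1. (4 * \<kappa>s * step t k) * a k)" if m: "m \<in> {1..n}" for m
  proof -
    have "step t m \<le> max_step t N"
      unfolding max_step_def using m n by (intro Max_ge) auto
    then have "step t m \<le> 1 / (4 * \<kappa>s)"
      using assms(16) by linarith
    then have "2 * \<kappa>s * step t m \<le> 1 / 2"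
      using \<kappa>s by (simp add: field_simps)
    \<comment> \<open>The step-size restriction lets the last summand of \<open>bound\<close> be
      absorbed into the left side. The remaining half of \<open>a m\<close> is then doubled, which
      produces the factor \<open>2\<close> in \<open>B\<close> and the rate
      \<open>4 * \<kappa>s\<close>.\<close>
    then have half: "2 * \<kappa>s * step t m * a m \<le> 1 / 2 * a m"
      using a0 by (intro mult_right_mono) auto
    obtain l where l: "m = Suc l" using m by (cases m) auto
    define Q where "Q = (\<Sum>k=1..l. step t k * a k)"
    have "(\<Sum>k=1..m. step t k * a k) = Q + step t m * a m"
      by (simp add: l Q_def)
    then have "2 * \<kappa>s * (\<Sum>k=1..m. step t k * a k) = 2 * \<kappa>s * Q + 2 * \<kappa>s * step t m * a m"
      by (simp add: distrib_left)
    then have "a m \<le> 2 * (a 0 + 2 * F m) + 4 * \<kappa>s * Q"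
      using bound[OF m] half by simp
    then show ?thesis
      using F_mono[OF m] by (simp add: B_def l Q_def sum_distrib_left mult_ac)
  qed
  have "0 \<le> F n"
    unfolding F_def using n \<theta>0
    by (auto intro!: sum_nonneg mult_nonneg_nonneg L2_norm_nonneg)
  then have B0: "0 \<le> B"
    using a0[of 0] by (simp add: B_def)
  \<comment> \<open>After the absorption the sum stops at \<open>n - 1\<close>, hence the exponent
    contains \<open>t (n - 1)\<close>.\<close>
  have "a n \<le> B + (\<Sum>k=1..n-1. (4 * \<kappa>s * step t k) * a k)"
    using n by (intro rec) auto
  also have "\<dots> \<le> B * exp (\<Sum>k=1..n-1. 4 * \<kappa>s * step t k)"
  proof (rule discrete_gronwall)
    show "0 \<le> 4 * \<kappa>s * step t k" if "k \<in> {1..n-1}" for k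
    proof -
      have "k \<in> {1..N}" using that n by auto
      then show ?thesis using s0[of k] \<kappa>s by simp
    qed
  qed (use rec B0 in auto)
  also have "(\<Sum>k=1..n-1. 4 * \<kappa>s * step t k) = 4 * \<kappa>s * t (n - 1)"
    by (simp only: sum_distrib_left[symmetric] time_mesh_sum_step[OF mesh])
  finally show "L2_norm \<Omega> (u n) \<le>
      2 * exp (4 * \<kappa>s * t (n - 1)) *
        (L2_norm \<Omega> (u 0) +
         2 * (\<Sum>k=1..n. \<Sum>j=1..k. doc_kernel (bdf2_kernel t) k (k - j) * L2_norm \<Omega> (f j)))"
    unfolding a_def B_def F_def \<theta>_def by (simp only: mult_ac)
qed

end
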